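(* Let $R$ be a Noetherian commutative ring of prime characteristic $p$. Let $\mathfrak{a}, J\subseteq R$ be ideals such that $\mathfrak{a} \subseteq \sqrt{J}$. If $\nu_{\mathfrak{a}}^J(p^e) := \max\{t \in \mathbb{N} \mid \mathfrak{a}^t \not\subseteq J^{[p^e]} \}$, then the $F$-threshold $$c^J(\mathfrak{a}) = \lim_{e\to \infty} \frac{ \nu^J_{\mathfrak{a}}(p^{e})}{p^e}$$ exists.
   Context: Convention: $0\in\mathbb{N}$. For an ideal $J$ of a ring of prime characteristic $p$ and $e\in\mathbb{N}$, $J^{[p^e]}$ denotes the ideal generated by the $p^e$-th powers of the elements of $J$; $J^{[p^0]}=J$. The number $c^J(\mathfrak{a})$ defined by the limit is called the $F$-threshold of $\mathfrak{a}$ with respect to $J$. *)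

theory Defs
  imports
    Complex_Main
    "HOL-Computational_Algebra.Primes"
    "HOL-Algebra.Ring_Divisibility"
    "HOL-Algebra.Ideal_Product"
begin

definition ring_characteristic :: "('a, 'b) ring_scheme \<Rightarrow> nat" where
  "ring_characteristic R =
     (if \<exists>n::nat. 0 < n \<and> add_pow R n \<one>\<^bsub>R\<^esub> = \<zero>\<^bsub>R\<^esub>
      then (LEAST n::nat. 0 < n \<and> add_pow R n \<one>\<^bsub>R\<^esub> = \<zero>\<^bsub>R\<^esub>)
      else 0)"

definition ideal_radical :: "('a, 'b) ring_scheme \<Rightarrow> 'a set \<Rightarrow> 'a set" where
  "ideal_radical R J = {x \<in> carrier R. \<exists>n::nat. 0 < n \<and> x [^]\<^bsub>R\<^esub> n \<in> J}"

text \<open>Powers of an ideal are taken in the semiring \<open>ideals_set R\<close>, so that the zeroth power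
  is the unit ideal.\<close>

definition ideal_power :: "('a, 'b) ring_scheme \<Rightarrow> 'a set \<Rightarrow> nat \<Rightarrow> 'a set" where
  "ideal_power R I t = I [^]\<^bsub>ideals_set R\<^esub> t"

definition frobenius_power :: "('a, 'b) ring_scheme \<Rightarrow> 'a set \<Rightarrow> nat \<Rightarrow> 'a set" where
  "frobenius_power R J q = genideal R ((\<lambda>x. x [^]\<^bsub>R\<^esub> q) ` J)"

text \<open>The set below is empty exactly when the Frobenius power is the unit ideal (in
  particular when \<open>J\<close> is); the maximum of the empty set is then read as \<open>0\<close>. For
  Noetherian \<open>R\<close> and \<open>\<aa>\<close> contained in the radical of \<open>J\<close> the set is finite, so
  \<open>Max\<close> is the genuine maximum.\<close>

definition nu :: "('a, 'b) ring_scheme \<Rightarrow> 'a set \<Rightarrow> 'a set \<Rightarrow> nat \<Rightarrow> nat" where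
  "nu R \<aa> J q =
     (let T = {t. \<not> ideal_power R \<aa> t \<subseteq> frobenius_power R J q}
      in if T = {} then 0 else Max T)"

text \<open>\<open>lim\<close> is unspecified for a divergent sequence: that a sequence tends to its
  \<open>lim\<close> is precisely the statement that it converges.\<close>

definition F_threshold :: "('a, 'b) ring_scheme \<Rightarrow> 'a set \<Rightarrow> 'a set \<Rightarrow> real" where
  "F_threshold R \<aa> J =
     lim (\<lambda>e. real (nu R \<aa> J (ring_characteristic R ^ e)) / real (ring_characteristic R ^ e))"

end

theory Submission
  imports Defs
begin

text \<open>Let \<open>N q\<close> be the least \<open>n\<close> with \<open>\<aa>\<^sup>n \<subseteq> J\<^bsup>[q]\<^esup>\<close>, so that \<open>\<nu> q = N q - 1\<close>
  (truncated when \<open>J\<close> is the unit ideal, where \<open>N q = 0\<close>). If \<open>\<aa>\<close> has \<open>\<mu>\<close>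
  generators, then a monomial of degree at least \<open>p (n + \<mu>)\<close> in them is a multiple of the \<open>p\<close>-th
  power of a monomial of degree at least \<open>n\<close>; as the Frobenius map is a ring homomorphism, this
  yields \<open>N (p q) \<le> p (N q + \<mu>)\<close>. Hence \<open>(N (p\<^sup>e) + 2 \<mu>) / p\<^sup>e\<close> is decreasing in \<open>e\<close> and
  bounded below, and its limit is that of \<open>\<nu> (p\<^sup>e) / p\<^sup>e\<close>.\<close>

section \<open>The binomial theorem and additivity of the Frobenius map\<close>

lemma (in cring) binomial_expansion:
  assumes x: "x \<in> carrier R" and y: "y \<in> carrier R"
  shows "(x \<oplus> y) [^] n = (\<Oplus>k\<in>{..n}. [(n choose k)] \<cdot> (x [^] k \<otimes> y [^] (n - k)))"
proof (induction n)
  case 0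
  then show ?case by simp
next
  case (Suc n)
  let ?m = "\<lambda>k. x [^] k \<otimes> y [^] (Suc n - k)"
  let ?u = "\<lambda>k. [(n choose k)] \<cdot> ?m k"
  \<comment> \<open>\<open>?v\<close> is the old summand times \<open>x\<close>, shifted by one and
    set to zero at \<open>k = 0\<close>; \<open>?u (Suc n)\<close> vanishes because
    \<open>n choose Suc n = 0\<close>. Both sums therefore run over \<open>{..Suc n}\<close>, and
    Pascal's rule adds them termwise.\<close>
  let ?v = "\<lambda>k. if k = 0 then \<zero> else [(n choose (k - 1))] \<cdot> ?m k"
  have m: "?m k \<in> carrier R" for k using x y by simp
  have t: "[(n choose k)] \<cdot> (x [^] k \<otimes> y [^] (n - k)) \<in> carrier R" for k using x y by simp
  have "(x \<oplus> y) [^] Suc n = (\<Oplus>k\<in>{..n}. [(n choose k)] \<cdot> (x [^] k \<otimes> y [^] (n - k))) \<otimes> x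
      \<oplus> (\<Oplus>k\<in>{..n}. [(n choose k)] \<cdot> (x [^] k \<otimes> y [^] (n - k))) \<otimes> y"
    using Suc x y t by (simp add: r_distr finsum_closed Pi_def)
  also have "(\<Oplus>k\<in>{..n}. [(n choose k)] \<cdot> (x [^] k \<otimes> y [^] (n - k))) \<otimes> y = (\<Oplus>k\<in>{..n}. ?u k)"
  proof -
    have "[(n choose k)] \<cdot> (x [^] k \<otimes> y [^] (n - k)) \<otimes> y = ?u k" if "k \<le> n" for k
      using x y that by (simp add: add_pow_ldistr m_assoc Suc_diff_le)
    then show ?thesis
      using x y t by (subst finsum_ldistr) (auto intro!: finsum_cong')
  qed
  also have "\<dots> = (\<Oplus>k\<in>{..Suc n}. ?u k)"
    using m by (subst finsum_Suc) (auto simp: finsum_closed binomial_eq_0)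
  also have "(\<Oplus>k\<in>{..n}. [(n choose k)] \<cdot> (x [^] k \<otimes> y [^] (n - k))) \<otimes> x = (\<Oplus>k\<in>{..n}. ?v (Suc k))"
  proof -
    have "[(n choose k)] \<cdot> (x [^] k \<otimes> y [^] (n - k)) \<otimes> x = ?v (Suc k)" for k
      using x y by (simp add: add_pow_ldistr add_pow_rdistr m_ac)
    then show ?thesis
      using x y t by (subst finsum_ldistr) (auto intro!: finsum_cong')
  qed
  also have "\<dots> = (\<Oplus>k\<in>{..Suc n}. ?v k)"
    using m x y by (subst finsum_Suc2) (auto simp: Pi_def intro!: finsum_closed r_zero [symmetric])
  also have "\<dots> \<oplus> (\<Oplus>k\<in>{..Suc n}. ?u k) = (\<Oplus>k\<in>{..Suc n}. ?v k \<oplus> ?u k)"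
    using m by (intro finsum_addf [symmetric]) auto
  also have "\<dots> = (\<Oplus>k\<in>{..Suc n}. [(Suc n choose k)] \<cdot> ?m k)"
  proof (intro finsum_cong')
    fix k
    show "?v k \<oplus> ?u k = [(Suc n choose k)] \<cdot> ?m k"
    proof (cases k)
      case 0
      then show ?thesis using x y by simp
    next
      case (Suc j)
      then show ?thesis
        using add.nat_pow_mult [OF m [of "Suc j"], of "n choose j" "n choose Suc j"] by simp
    qed
  qed (use m in auto)
  finally show ?case .
qed

text \<open>The prime \<open>p\<close> divides every inner binomial coefficient, and multiples of
  \<open>p\<close> annihilate the ring because \<open>p\<close> annihilates \<open>\<one>\<close>;
  only the two outer terms survive.\<close>

lemma (in cring) frobenius_add:
  fixes p :: nat
  assumes p: "Factorial_Ring.prime p" and char: "add_pow R p \<one> = \<zero>"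
    and x: "x \<in> carrier R" and y: "y \<in> carrier R"
  shows "(x \<oplus> y) [^] p = x [^] p \<oplus> y [^] p"
proof -
  obtain n where n: "p = Suc n" using p prime_gt_0_nat gr0_implies_Suc by blast
  let ?t = "\<lambda>k. [(p choose k)] \<cdot> (x [^] k \<otimes> y [^] (p - k))"
  have t: "?t k \<in> carrier R" for k using x y by simp
  have kill: "[(j * p)] \<cdot> z = \<zero>" if "z \<in> carrier R" for z j
  proof -
    have "[p] \<cdot> z = \<zero>" using add_pow_ldistr [of \<one> z p] that char by simp
    then show ?thesis using add.nat_pow_pow [OF that, of j p] by (simp add: mult.commute)
  qed
  have mid: "?t k = \<zero>" if k: "k \<in> {1..n}" for k
  proof -
    have "p dvd p choose k" using p k n by (intro dvd_choose_prime) auto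
    then obtain j where "p choose k = j * p" by (metis dvd_def mult.commute)
    then show ?thesis using kill x y by simp
  qed
  have "(x \<oplus> y) [^] p = (\<Oplus>k\<in>{..Suc n}. ?t k)"
    unfolding binomial_expansion [OF x y] n by simp
  also have "\<dots> = ?t (Suc n) \<oplus> (\<Oplus>k\<in>{..n}. ?t k)"
    using t by (intro finsum_Suc) auto
  also have "(\<Oplus>k\<in>{..n}. ?t k) = (\<Oplus>k\<in>{0}. ?t k)"
    using t mid by (intro add.finprod_mono_neutral_cong_right) auto
  also have "\<dots> = y [^] p" using x y by simp
  finally show ?thesis using x y n by simp
qed

section \<open>Ideals that reduce inclusions to generators\<close>

text \<open>Additivity comes from \<open>frobenius_add\<close>. Since this preimage is an ideal,
  having \<open>p\<close>-th powers in \<open>K\<close> spreads from generators to the ideal they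
  generate.\<close>

lemma (in cring) ideal_frobenius_vimage:
  fixes p :: nat
  assumes p: "Factorial_Ring.prime p" and char: "add_pow R p \<one> = \<zero>" and K: "ideal K R"
  shows "ideal {y \<in> carrier R. y [^] p \<in> K} R"
proof (rule idealI)
  show "ring R" by (rule ring_axioms)
  interpret K: ideal K R by (rule K)
  have mult: "(a \<otimes> x) [^] p \<in> K" if "a \<in> carrier R" "a [^] p \<in> K" "x \<in> carrier R" for a x
    using that K.I_r_closed by (simp add: nat_pow_distrib)
  then show "a \<otimes> x \<in> {y \<in> carrier R. y [^] p \<in> K}"
    if "a \<in> {y \<in> carrier R. y [^] p \<in> K}" "x \<in> carrier R" for a x
    using that by auto
  then show "x \<otimes> a \<in> {y \<in> carrier R. y [^] p \<in> K}"
    if "a \<in> {y \<in> carrier R. y [^] p \<in> K}" "x \<in> carrier R" for a x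
    using that by (metis (no_types, lifting) m_comm mem_Collect_eq)
  have "p > 0" using p prime_gt_0_nat by blast
  show "subgroup {y \<in> carrier R. y [^] p \<in> K} (add_monoid R)"
  proof (rule add.subgroupI)
    show "{y \<in> carrier R. y [^] p \<in> K} \<noteq> {}"
      using \<open>p > 0\<close> K.zero_closed by (auto simp: nat_pow_zero intro!: exI [of _ \<zero>])
    \<comment> \<open>Negation is multiplication by \<open>\<ominus> \<one>\<close>, so the parity
      of \<open>p\<close> need not be discussed.\<close>
    show "\<ominus> a \<in> {y \<in> carrier R. y [^] p \<in> K}" if "a \<in> {y \<in> carrier R. y [^] p \<in> K}" for a
      using mult [of a "\<ominus> \<one>"] that by (simp add: r_minus)
    show "a \<oplus> b \<in> {y \<in> carrier R. y [^] p \<in> K}"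
      if "a \<in> {y \<in> carrier R. y [^] p \<in> K}" "b \<in> {y \<in> carrier R. y [^] p \<in> K}" for a b
      using that K.a_closed by (simp add: frobenius_add [OF p char])
  qed auto
qed

text \<open>The colon ideal of \<open>K\<close> by \<open>G\<close>: it lets one factor of a product
  be tested on generators while the other ranges over \<open>G\<close>.\<close>

lemma (in cring) ideal_colon:
  assumes K: "ideal K R" and G: "G \<subseteq> carrier R"
  shows "ideal {x \<in> carrier R. \<forall>g\<in>G. x \<otimes> g \<in> K} R"
proof (rule idealI)
  show "ring R" by (rule ring_axioms)
  interpret K: ideal K R by (rule K)
  let ?C = "{x \<in> carrier R. \<forall>g\<in>G. x \<otimes> g \<in> K}"
  show l: "x \<otimes> a \<in> ?C" if "a \<in> ?C" "x \<in> carrier R" for a x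
    using that G K.I_l_closed by (auto simp: m_assoc subset_iff)
  then show "a \<otimes> x \<in> ?C" if "a \<in> ?C" "x \<in> carrier R" for a x
    using that by (metis (no_types, lifting) m_comm mem_Collect_eq)
  show "subgroup ?C (add_monoid R)"
  proof (rule add.subgroupI)
    show "?C \<noteq> {}"
      using G K.zero_closed by (auto simp: subset_iff intro!: exI [of _ \<zero>])
    show "\<ominus> a \<in> ?C" if "a \<in> ?C" for a
      using l [of a "\<ominus> \<one>"] that by (simp add: l_minus)
    show "a \<oplus> b \<in> ?C" if "a \<in> ?C" "b \<in> ?C" for a b
      using that G K.a_closed by (auto simp: l_distr subset_iff)
  qed auto
qed

text \<open>Two passes with colon ideals: the one by \<open>S\<close> contains \<open>T\<close>,
  hence \<open>Idl T\<close>; then the one by \<open>Idl T\<close> contains \<open>S\<close>, hence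
  \<open>Idl S\<close>. Commutativity swaps the factors in between, and sums of products stay in
  \<open>K\<close>.\<close>

lemma (in cring) ideal_prod_genideal_subset:
  assumes S: "S \<subseteq> carrier R" and T: "T \<subseteq> carrier R" and K: "ideal K R"
    and ST: "\<And>s t. s \<in> S \<Longrightarrow> t \<in> T \<Longrightarrow> s \<otimes> t \<in> K"
  shows "(Idl S) \<cdot> (Idl T) \<subseteq> K"
proof
  interpret K: ideal K R by (rule K)
  have "t \<otimes> s \<in> K" if "s \<in> S" "t \<in> T" for s t
    using that ST [OF that] m_comm [of s t] S T by (metis subsetD)
  then have "Idl T \<subseteq> {x \<in> carrier R. \<forall>g\<in>S. x \<otimes> g \<in> K}"
    using T by (intro genideal_minimal ideal_colon K S) blast
  then have t: "t \<otimes> s \<in> K" if "t \<in> Idl T" "s \<in> S" for s t using that by blast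
  have Tc: "Idl T \<subseteq> carrier R" using ideal.Icarr [OF genideal_ideal [OF T]] by blast
  have "s \<otimes> t \<in> K" if "s \<in> S" "t \<in> Idl T" for s t
    using that t [of t s] m_comm [of s t] S Tc by (metis subsetD)
  then have "Idl S \<subseteq> {x \<in> carrier R. \<forall>g\<in>Idl T. x \<otimes> g \<in> K}"
    using S by (intro genideal_minimal ideal_colon K Tc) blast
  then have s: "s \<otimes> t \<in> K" if "s \<in> Idl S" "t \<in> Idl T" for s t using that by blast
  fix z assume "z \<in> (Idl S) \<cdot> (Idl T)"
  then show "z \<in> K"
    by (induction rule: ideal_prod.induct) (auto simp: s K.a_closed)
qed

section \<open>Powers of an ideal and monomials in its generators\<close>

lemma (in cring) monoid_ideals_set: "monoid (ideals_set R)"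
  using ideals_set_is_semiring semiring.axioms(2) comm_monoid.axioms(1) by blast

lemma ideal_power_0 [simp]: "ideal_power R I 0 = carrier R"
  by (simp add: ideal_power_def ideals_set_def)

lemma ideal_power_Suc: "ideal_power R I (Suc n) = ideal_power R I n \<cdot>\<^bsub>R\<^esub> I"
  by (simp add: ideal_power_def ideals_set_def)

lemma (in cring) ideal_ideal_power:
  assumes "ideal I R"
  shows "ideal (ideal_power R I n) R"
  by (induction n) (auto simp: ideal_power_Suc oneideal intro: ideal_prod_is_ideal assms)

lemma (in cring) ideal_power_add:
  assumes "ideal I R"
  shows "ideal_power R I (m + n) = ideal_power R I m \<cdot> ideal_power R I n"
  using monoid.nat_pow_mult [OF monoid_ideals_set, of I m n] assms
  by (simp add: ideal_power_def ideals_set_def)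

lemma (in cring) ideal_power_antimono:
  assumes I: "ideal I R" and "m \<le> n"
  shows "ideal_power R I n \<subseteq> ideal_power R I m"
  using ideal_power_add [OF I, of m "n - m"] \<open>m \<le> n\<close>
    ideal_prod_inter [OF ideal_ideal_power [OF I, of m] ideal_ideal_power [OF I, of "n - m"]]
  by auto

lemma (in cring) nat_pow_mem_ideal_power:
  assumes "ideal I R" and "g \<in> I"
  shows "g [^] (n::nat) \<in> ideal_power R I n"
  by (induction n) (auto simp: ideal_power_Suc intro: ideal_prod.prod assms)

lemma (in cring) monomial_mem_ideal_power:
  assumes I: "ideal I R" and "finite G" and "G \<subseteq> I"
  shows "(\<Otimes>g\<in>G. g [^] (f g :: nat)) \<in> ideal_power R I (sum f G)"
  using assms(2,3)
proof (induction rule: finite_induct)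
  case empty
  then show ?case by simp
next
  case (insert g G)
  have "insert g G \<subseteq> carrier R" using insert.prems ideal.Icarr [OF I] by blast
  then have "(\<Otimes>h\<in>insert g G. h [^] f h) = g [^] f g \<otimes> (\<Otimes>h\<in>G. h [^] f h)"
    using insert.hyps by (intro finprod_insert) auto
  moreover have "g [^] f g \<in> ideal_power R I (f g)"
    using insert.prems nat_pow_mem_ideal_power [OF I] by blast
  moreover have "(\<Otimes>h\<in>G. h [^] f h) \<in> ideal_power R I (sum f G)"
    using insert.prems by (intro insert.IH) simp
  moreover have "sum f (insert g G) = f g + sum f G"
    using insert.hyps by (rule sum.insert)
  ultimately show ?case
    by (simp only: ideal_power_add [OF I] ideal_prod.prod)
qed

text \<open>A monomial of degree \<open>n\<close> times a generator is a monomial of degree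
  \<open>Suc n\<close>. Consequently, containment of a power in an ideal can be checked on
  monomials.\<close>

lemma (in cring) ideal_power_genideal_subset:
  assumes fin: "finite G" and G: "G \<subseteq> carrier R"
  shows "ideal_power R (Idl G) n \<subseteq> Idl {\<Otimes>g\<in>G. g [^] f g | f :: 'a \<Rightarrow> nat. sum f G = n}"
proof (induction n)
  have M: "{\<Otimes>g\<in>G. g [^] f g | f :: 'a \<Rightarrow> nat. sum f G = n} \<subseteq> carrier R" for n
    using G by (auto intro!: finprod_closed)
  {
    case 0
    have "\<one> \<in> {\<Otimes>g\<in>G. g [^] f g | f :: 'a \<Rightarrow> nat. sum f G = 0}"
      by (auto intro!: exI [of _ "\<lambda>_. 0"])
    then have "\<one> \<in> Idl {\<Otimes>g\<in>G. g [^] f g | f :: 'a \<Rightarrow> nat. sum f G = 0}"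
      using genideal_self [OF M] by blast
    then show ?case
      using ideal.one_imp_carrier [OF genideal_ideal [OF M]] by simp
  next
    case (Suc n)
    let ?K = "Idl {\<Otimes>g\<in>G. g [^] f g | f :: 'a \<Rightarrow> nat. sum f G = Suc n}"
    have "s \<otimes> t \<in> ?K"
      if s: "s \<in> {\<Otimes>g\<in>G. g [^] f g | f :: 'a \<Rightarrow> nat. sum f G = n}" and t: "t \<in> G" for s t
    proof -
      obtain f :: "'a \<Rightarrow> nat" where f: "s = (\<Otimes>g\<in>G. g [^] f g)" "sum f G = n" using s by blast
      let ?f = "f(t := Suc (f t))"
      \<comment> \<open>\<open>A\<close> is the part of the monomial away from \<open>t\<close>;
        passing from \<open>f\<close> to \<open>?f\<close> leaves it unchanged.\<close>
      define A where "A = (\<Otimes>g\<in>G - {t}. g [^] f g)"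
      have A: "A \<in> carrier R" unfolding A_def using G by (intro finprod_closed) auto
      have tc: "t \<in> carrier R" using t G by blast
      have split: "(\<Otimes>g\<in>G. g [^] h g) = t [^] h t \<otimes> (\<Otimes>g\<in>G - {t}. g [^] h g)"
        for h :: "'a \<Rightarrow> nat"
        using finprod_insert [of "G - {t}" t "\<lambda>g. g [^] h g"] fin G t
        by (auto simp: insert_absorb Pi_def)
      have "(\<Otimes>g\<in>G - {t}. g [^] ?f g) = A"
        unfolding A_def using G by (intro finprod_cong') auto
      then have "(\<Otimes>g\<in>G. g [^] ?f g) = t [^] Suc (f t) \<otimes> A"
        using split [of ?f] by simp
      also have "\<dots> = (t [^] f t \<otimes> A) \<otimes> t"
        using A tc by (simp add: m_ac)
      also have "t [^] f t \<otimes> A = s"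
        unfolding f(1) A_def by (rule split [symmetric])
      finally have 1: "s \<otimes> t = (\<Otimes>g\<in>G. g [^] ?f g)" by (rule sym)
      have 2: "sum ?f G = Suc n"
        using f(2) fin t by (simp add: sum.remove [of G t])
      have "s \<otimes> t \<in> {\<Otimes>g\<in>G. g [^] f g | f :: 'a \<Rightarrow> nat. sum f G = Suc n}"
        by (intro CollectI exI [of _ ?f] conjI 1 2)
      then show ?thesis using genideal_self [OF M] by blast
    qed
    then have "(Idl {\<Otimes>g\<in>G. g [^] f g | f :: 'a \<Rightarrow> nat. sum f G = n}) \<cdot> (Idl G) \<subseteq> ?K"
      using M G by (intro ideal_prod_genideal_subset genideal_ideal) auto
    \<comment> \<open>The induction hypothesis enters through monotonicity of the ideal product in
      its left factor.\<close>
    moreover have "ideal_power R (Idl G) n \<cdot> (Idl G)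
        \<subseteq> (Idl {\<Otimes>g\<in>G. g [^] f g | f :: 'a \<Rightarrow> nat. sum f G = n}) \<cdot> (Idl G)"
    proof
      fix z assume "z \<in> ideal_power R (Idl G) n \<cdot> (Idl G)"
      then show "z \<in> (Idl {\<Otimes>g\<in>G. g [^] f g | f :: 'a \<Rightarrow> nat. sum f G = n}) \<cdot> (Idl G)"
        using Suc by (induction rule: ideal_prod.induct) (auto intro: ideal_prod.intros)
    qed
    ultimately show ?case unfolding ideal_power_Suc by blast
  }
qed

text \<open>Pigeonhole: if \<open>g [^] k g\<close> lies in \<open>J\<close> for each generator, a
  monomial of degree above \<open>sum k G\<close> has some exponent \<open>f g\<close> exceeding
  \<open>k g\<close>, so it is a multiple of an element of \<open>J\<close>.\<close>

lemma (in cring) ideal_power_subset_of_radical: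
  assumes fin: "finite G" and J: "ideal J R" and rad: "G \<subseteq> ideal_radical R J"
  shows "\<exists>n. ideal_power R (Idl G) n \<subseteq> J"
proof -
  interpret J: ideal J R by (rule J)
  have G: "G \<subseteq> carrier R" using rad by (auto simp: ideal_radical_def)
  have "\<forall>g\<in>G. \<exists>k::nat. g [^] k \<in> J" using rad by (auto simp: ideal_radical_def)
  then obtain k :: "'a \<Rightarrow> nat" where k: "\<And>g. g \<in> G \<Longrightarrow> g [^] k g \<in> J" by metis
  have "(\<Otimes>g\<in>G. g [^] f g) \<in> J" if f: "sum f G = Suc (sum k G)" for f :: "'a \<Rightarrow> nat"
  proof -
    have "\<not> sum f G \<le> sum k G" using f by simp
    then have "\<exists>g\<in>G. \<not> f g \<le> k g" using sum_mono [of G f k] by blast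
    then obtain g where g: "g \<in> G" "k g \<le> f g" by force
    have gc: "g \<in> carrier R" using g G by blast
    define A where "A = (\<Otimes>h\<in>G - {g}. h [^] f h)"
    have A: "A \<in> carrier R" unfolding A_def using G by (intro finprod_closed) auto
    have "(\<Otimes>h\<in>G. h [^] f h) = g [^] f g \<otimes> A"
      using finprod_insert [of "G - {g}" g "\<lambda>h. h [^] f h"] fin G g
      by (auto simp: insert_absorb Pi_def A_def)
    also have "g [^] f g = g [^] k g \<otimes> g [^] (f g - k g)"
      using g(2) gc by (simp add: nat_pow_mult)
    also have "g [^] k g \<otimes> g [^] (f g - k g) \<otimes> A \<in> J"
      using A gc by (intro J.I_r_closed k g nat_pow_closed)
    finally show ?thesis .
  qed
  then have "Idl {\<Otimes>g\<in>G. g [^] f g | f :: 'a \<Rightarrow> nat. sum f G = Suc (sum k G)} \<subseteq> J"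
    by (intro genideal_minimal J) auto
  then show ?thesis using ideal_power_genideal_subset [OF fin G] by blast
qed

section \<open>Frobenius powers and the passage from \<open>q\<close> to
  \<open>q * p\<close>\<close>

lemma (in cring) subset_frobenius_power_1:
  assumes J: "J \<subseteq> carrier R"
  shows "J \<subseteq> frobenius_power R J 1"
proof -
  have "(\<lambda>x. x [^] (1::nat)) ` J = J" using J by (force simp: subset_iff)
  then show ?thesis using genideal_self [OF J] by (simp add: frobenius_power_def)
qed

lemma (in cring) ideal_frobenius_power:
  assumes "J \<subseteq> carrier R"
  shows "ideal (frobenius_power R J q) R"
  unfolding frobenius_power_def using assms by (intro genideal_ideal) auto

text \<open>The generators \<open>x [^] q\<close> have \<open>p\<close>-th powers
  \<open>x [^] (q * p)\<close>, so they lie in the Frobenius preimage of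
  \<open>frobenius_power R J (q * p)\<close>. That preimage is an ideal and hence contains all of
  \<open>frobenius_power R J q\<close>.\<close>

lemma (in cring) nat_pow_mem_frobenius_power:
  fixes p :: nat
  assumes p: "Factorial_Ring.prime p" and char: "add_pow R p \<one> = \<zero>" and J: "J \<subseteq> carrier R"
    and y: "y \<in> frobenius_power R J q"
  shows "y [^] p \<in> frobenius_power R J (q * p)"
proof -
  have "(\<lambda>x. x [^] (q * p)) ` J \<subseteq> frobenius_power R J (q * p)"
    unfolding frobenius_power_def using J by (intro genideal_self) auto
  then have "frobenius_power R J q \<subseteq> {y \<in> carrier R. y [^] p \<in> frobenius_power R J (q * p)}"
    unfolding frobenius_power_def [of R J q]
    using J ideal_frobenius_power [OF J]
    by (intro genideal_minimal ideal_frobenius_vimage p char) (auto simp: nat_pow_pow subset_iff)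
  then show ?thesis using y by blast
qed

lemma (in cring) monomial_div_mod:
  fixes f :: "'a \<Rightarrow> nat" and p :: nat
  assumes "finite G" and "G \<subseteq> carrier R"
  shows "(\<Otimes>g\<in>G. g [^] f g)
    = (\<Otimes>g\<in>G. g [^] (f g div p)) [^] p \<otimes> (\<Otimes>g\<in>G. g [^] (f g mod p))"
  using assms
proof (induction rule: finite_induct)
  case empty
  then show ?case by simp
next
  case (insert h G)
  have h: "h \<in> carrier R" using insert.prems by simp
  \<comment> \<open>\<open>c\<close> and \<open>i\<close> are stated for every exponent function
    because quotients and remainders by \<open>p\<close> are needed besides \<open>f\<close>
    itself.\<close>
  have c: "(\<Otimes>g\<in>G. g [^] (e g :: nat)) \<in> carrier R" for e
    using insert.prems by (intro finprod_closed) auto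
  have i: "(\<Otimes>g\<in>insert h G. g [^] (e g :: nat)) = h [^] e h \<otimes> (\<Otimes>g\<in>G. g [^] e g)" for e
    using insert.hyps insert.prems by (intro finprod_insert) auto
  have pow: "h [^] f h = (h [^] (f h div p)) [^] p \<otimes> h [^] (f h mod p)"
    using h by (simp add: nat_pow_pow nat_pow_mult)
  have swap: "(a [^] p \<otimes> b) \<otimes> (B [^] p \<otimes> C) = (a \<otimes> B) [^] p \<otimes> (b \<otimes> C)"
    if "a \<in> carrier R" "b \<in> carrier R" "B \<in> carrier R" "C \<in> carrier R" for a b B C
    using that by (simp add: nat_pow_distrib m_ac)
  have IH: "(\<Otimes>g\<in>G. g [^] f g)
      = (\<Otimes>g\<in>G. g [^] (f g div p)) [^] p \<otimes> (\<Otimes>g\<in>G. g [^] (f g mod p))"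
    using insert.prems by (intro insert.IH) simp
  show ?case
    unfolding i IH by (subst pow) (intro swap nat_pow_closed h c)
qed

text \<open>Divide the exponents of a monomial by \<open>p\<close>: the quotient monomial
  \<open>?m\<close> has degree at least \<open>n\<close>, so it lies in
  \<open>frobenius_power R J q\<close> and its \<open>p\<close>-th power in the next Frobenius
  power. The remainder monomial \<open>?r\<close> is a harmless cofactor.\<close>

lemma (in cring) ideal_power_subset_frobenius_power_step:
  fixes p :: nat
  assumes p: "Factorial_Ring.prime p" and char: "add_pow R p \<one> = \<zero>" and J: "J \<subseteq> carrier R"
    and fin: "finite G" and G: "G \<subseteq> carrier R"
    and n: "ideal_power R (Idl G) n \<subseteq> frobenius_power R J q"
  shows "ideal_power R (Idl G) (p * (n + card G)) \<subseteq> frobenius_power R J (q * p)"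
proof -
  have p0: "p > 0" using p prime_gt_0_nat by blast
  interpret F: ideal "frobenius_power R J (q * p)" R by (rule ideal_frobenius_power [OF J])
  have IG: "ideal (Idl G) R" by (rule genideal_ideal [OF G])
  have "(\<Otimes>g\<in>G. g [^] f g) \<in> frobenius_power R J (q * p)"
    if f: "sum f G = p * (n + card G)" for f :: "'a \<Rightarrow> nat"
  proof -
    let ?m = "\<Otimes>g\<in>G. g [^] (f g div p)" and ?r = "\<Otimes>g\<in>G. g [^] (f g mod p)"
    have "sum f G = p * (\<Sum>g\<in>G. f g div p) + (\<Sum>g\<in>G. f g mod p)"
      by (simp add: sum_distrib_left flip: sum.distrib)
    \<comment> \<open>Each remainder is below \<open>p\<close>; this total loss is what the summand
      \<open>card G\<close> in the degree pays for.\<close>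
    also have "(\<Sum>g\<in>G. f g mod p) \<le> card G * p"
      using sum_bounded_above [of G "\<lambda>g. f g mod p" p] less_imp_le [OF mod_less_divisor [OF p0]]
      by auto
    finally have "p * n \<le> p * (\<Sum>g\<in>G. f g div p)" using f by (simp add: algebra_simps)
    then have "n \<le> (\<Sum>g\<in>G. f g div p)" using p0 by simp
    moreover have "?m \<in> ideal_power R (Idl G) (\<Sum>g\<in>G. f g div p)"
      using monomial_mem_ideal_power [OF IG fin genideal_self [OF G]] .
    ultimately have "?m \<in> frobenius_power R J q"
      using ideal_power_antimono [OF IG] n by blast
    then have "?m [^] p \<in> frobenius_power R J (q * p)"
      by (rule nat_pow_mem_frobenius_power [OF p char J])
    moreover have "?r \<in> carrier R" using G by (intro finprod_closed) auto
    ultimately have "?m [^] p \<otimes> ?r \<in> frobenius_power R J (q * p)" by (rule F.I_r_closed)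
    then show ?thesis unfolding monomial_div_mod [OF fin G, of f p] .
  qed
  then have "Idl {\<Otimes>g\<in>G. g [^] f g | f :: 'a \<Rightarrow> nat. sum f G = p * (n + card G)}
      \<subseteq> frobenius_power R J (q * p)"
    by (intro genideal_minimal F.ideal_axioms) auto
  then show ?thesis using ideal_power_genideal_subset [OF fin G] by blast
qed

section \<open>The numbers \<open>nu\<close> and convergence\<close>

text \<open>Powers of an ideal decrease, so the exponents without containment form the initial
  segment \<open>{..<N}\<close>, with maximum \<open>N - 1\<close>. If \<open>N = 0\<close> the
  segment is empty, and the default \<open>0\<close> agrees with truncated subtraction.\<close>

lemma (in cring) nu_eq_Least:
  assumes I: "ideal I R" and n: "ideal_power R I n \<subseteq> frobenius_power R J q"
  shows "nu R I J q = (LEAST n. ideal_power R I n \<subseteq> frobenius_power R J q) - 1"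
proof -
  let ?P = "\<lambda>n. ideal_power R I n \<subseteq> frobenius_power R J q"
  define N where "N = (LEAST n. ?P n)"
  have "?P N" unfolding N_def using n by (rule LeastI)
  then have "?P t \<longleftrightarrow> N \<le> t" for t
    using ideal_power_antimono [OF I, of N t] Least_le [of ?P t] unfolding N_def by blast
  then have "{t. \<not> ?P t} = {..<N}" by auto
  moreover have "Max {..<N} = N - 1" if "N > 0"
    using that by (intro Max_eqI) auto
  ultimately show ?thesis unfolding nu_def Let_def N_def [symmetric] by auto
qed

text \<open>The correction term \<open>2 c / p\<^sup>e\<close> makes the sequence decreasing, because \<open>c + 2 c / p \<le> 2 c\<close>.\<close>

lemma convergent_of_scaled_step:
  fixes N :: "nat \<Rightarrow> nat" and p c :: nat
  assumes p: "p \<ge> 2" and step: "\<And>e. N (Suc e) \<le> p * (N e + c)"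
  shows "convergent (\<lambda>e. real (N e) / real (p ^ e))"
proof -
  let ?y = "\<lambda>e. real (N e + 2 * c) / real (p ^ e)"
  have "decseq ?y"
  proof (rule decseq_SucI)
    fix e
    have "N (Suc e) + 2 * c \<le> p * (N e + c) + p * c"
      using step [of e] p by (intro add_mono) auto
    then have "real (N (Suc e) + 2 * c) \<le> real (p * (N e + 2 * c))"
      by (intro of_nat_mono) (simp add: algebra_simps)
    then show "?y (Suc e) \<le> ?y e"
      using p by (simp add: divide_simps mult.commute)
  qed
  then obtain L where L: "?y \<longlonglongrightarrow> L"
    by (rule decseq_convergent [of _ 0]) auto
  \<comment> \<open>The correction term tends to zero, so subtracting it preserves the
    limit.\<close>
  have "(\<lambda>e. real (2 * c) * (1 / real p) ^ e) \<longlonglongrightarrow> real (2 * c) * 0"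
    using p by (intro tendsto_intros LIMSEQ_power_zero) auto
  then have "(\<lambda>e. ?y e - real (2 * c) * (1 / real p) ^ e) \<longlonglongrightarrow> L - real (2 * c) * 0"
    by (intro tendsto_diff L)
  moreover have "?y e - real (2 * c) * (1 / real p) ^ e = real (N e) / real (p ^ e)" for e
    by (simp add: power_divide add_divide_distrib)
  ultimately show ?thesis by (auto simp: convergent_def)
qed

text \<open>A positive value can only come from the \<open>LEAST\<close> branch, and a least element
  satisfies the property it minimizes.\<close>

lemma add_pow_ring_characteristic:
  assumes "ring_characteristic R > 0"
  shows "add_pow R (ring_characteristic R) \<one>\<^bsub>R\<^esub> = \<zero>\<^bsub>R\<^esub>"
proof -
  let ?Q = "\<lambda>n::nat. 0 < n \<and> add_pow R n \<one>\<^bsub>R\<^esub> = \<zero>\<^bsub>R\<^esub>"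
  have ex: "\<exists>n. ?Q n"
    using assms by (auto simp: ring_characteristic_def split: if_splits)
  show ?thesis
    using LeastI_ex [OF ex] unfolding ring_characteristic_def if_P [OF ex] by (rule conjunct2)
qed

theorem theorem1:
  fixes R :: "('a, 'b) ring_scheme" and \<aa> J :: "'a set" and p :: nat
  assumes "cring R" and "noetherian_ring R"
    and "Factorial_Ring.prime p" and "ring_characteristic R = p"
    and "ideal \<aa> R" and "ideal J R"
    and "\<aa> \<subseteq> ideal_radical R J"
  shows "(\<lambda>e. real (nu R \<aa> J (p ^ e)) / real (p ^ e)) \<longlonglongrightarrow> F_threshold R \<aa> J"
proof -
  interpret cring R by (rule assms(1))
  interpret noetherian_ring R by (rule assms(2))
  note p = assms(3)
  have p2: "p \<ge> 2" using p by (rule prime_ge_2_nat)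
  have char: "add_pow R p \<one>\<^bsub>R\<^esub> = \<zero>\<^bsub>R\<^esub>"
    using add_pow_ring_characteristic [of R] assms(4) p2 by simp
  have J: "J \<subseteq> carrier R" using ideal.Icarr [OF assms(6)] by blast
  \<comment> \<open>Noetherianity gives a finite generating set; its cardinality is a constant that
    serves for all \<open>e\<close> at once.\<close>
  obtain G where G: "G \<subseteq> carrier R" "finite G" and \<aa>: "\<aa> = genideal R G"
    using finetely_gen [OF assms(5)] by blast
  define P where "P e n \<longleftrightarrow> ideal_power R \<aa> n \<subseteq> frobenius_power R J (p ^ e)" for e n
  define N where "N e = (LEAST n. P e n)" for e
  have step: "P (Suc e) (p * (n + card G))" if "P e n" for e n
    using ideal_power_subset_frobenius_power_step [OF p char J G(2,1), of n "p ^ e"] that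
    by (simp add: P_def \<aa> mult.commute)
  \<comment> \<open>This makes every \<open>N e\<close> meaningful: the radical hypothesis settles
    \<open>e = 0\<close>, and \<open>step\<close> carries containment from each \<open>e\<close> to
    the next.\<close>
  have ex: "\<exists>n. P e n" for e
  proof (induction e)
    case 0
    have "J \<subseteq> frobenius_power R J 1" using J by (rule subset_frobenius_power_1)
    moreover have "\<exists>n. ideal_power R \<aa> n \<subseteq> J"
      using assms(7) genideal_self [OF G(1)] unfolding \<aa>
      by (intro ideal_power_subset_of_radical G assms(6)) auto
    ultimately show ?case by (auto simp: P_def)
  next
    case (Suc e)
    then show ?case using step by blast
  qed
  have PN: "P e (N e)" for e unfolding N_def using ex by (rule LeastI_ex)
  have N_step: "N (Suc e) \<le> p * (N e + card G)" for e
    unfolding N_def [of "Suc e"] by (intro Least_le step PN)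
  obtain L where L: "(\<lambda>e. real (N e) / real (p ^ e)) \<longlonglongrightarrow> L"
    using convergent_of_scaled_step [where N = N, OF p2 N_step] unfolding convergent_def by blast
  have nu: "nu R \<aa> J (p ^ e) = N e - 1" for e
    unfolding N_def P_def by (rule nu_eq_Least [OF assms(5)]) (rule PN [unfolded P_def])
  have inv: "(\<lambda>e. (1 / real p) ^ e) \<longlonglongrightarrow> 0"
    using p2 by (intro LIMSEQ_power_zero) auto
  \<comment> \<open>\<open>nu\<close> is at most \<open>N e\<close> and at least
    \<open>N e - 1\<close> as a real number, also when \<open>N e = 0\<close>; the gap divided by
    \<open>p ^ e\<close> is at most \<open>(1 / real p) ^ e\<close>, which vanishes in the
    limit.\<close>
  have "(\<lambda>e. real (nu R \<aa> J (p ^ e)) / real (p ^ e)) \<longlonglongrightarrow> L"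
  proof (rule tendsto_sandwich)
    show "(\<lambda>e. real (N e) / real (p ^ e) - (1 / real p) ^ e) \<longlonglongrightarrow> L"
      using tendsto_diff [OF L inv] by simp
    show "\<forall>\<^sub>F e in sequentially. real (N e) / real (p ^ e) - (1 / real p) ^ e
        \<le> real (nu R \<aa> J (p ^ e)) / real (p ^ e)"
      by (intro always_eventually allI)
        (auto simp: nu power_divide simp flip: diff_divide_distrib intro!: divide_right_mono)
    show "\<forall>\<^sub>F e in sequentially. real (nu R \<aa> J (p ^ e)) / real (p ^ e) \<le> real (N e) / real (p ^ e)"
      by (intro always_eventually allI divide_right_mono) (auto simp: nu)
  qed (rule L)
  \<comment> \<open>Convergence to some \<open>L\<close> suffices, since \<open>limI\<close>
    identifies \<open>L\<close> with the \<open>lim\<close> defining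
    \<open>F_threshold\<close>.\<close>
  then show ?thesis
    unfolding F_threshold_def assms(4) using limI by blast
qed

end
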